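(* Let $H$ be an infinite-dimensional separable complex Hilbert space, let $T,S\in\mathcal{B}(H)$, and suppose there exists a unitary operator $U$ on $H$ such that $T=U^*SU$. Then $T\in\mathcal{M}_r(H)$ if and only if $S\in\mathcal{M}_r(H)$.
   Context: $\mathcal{B}(H)$ denotes the bounded linear operators on $H$. For a nonzero Hilbert space $M$ and $A\in\mathcal{B}(M)$, the minimum modulus is $m(A)=\inf\{\|Ax\|: x\in M,\ \|x\|=1\}$; $A$ is minimum attaining if there is a unit vector $x_0\in M$ with $\|Ax_0\|=m(A)$. A closed subspace $M\subseteq H$ reduces $T\in\mathcal{B}(H)$ if $T(M)\subseteq M$ and $T^*(M)\subseteq M$. $\mathcal{M}_r(H)$ is the set of all $T\in\mathcal{B}(H)$ such that for every nonzero closed subspace $M$ reducing $T$, the restriction $T|_M:M\to M$ is minimum attaining. *)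

theory Defs
  imports "HOL-Analysis.Analysis"
begin

text \<open>
  Complex Hilbert spaces, built on top of the real Banach space structure of the library;
  real scaling is the restriction of complex scaling, and the norm is the one induced by the
  inner product.  The inner product is linear in its first argument.
\<close>

class complex_hilbert_space = banach +
  fixes scaleC :: "complex \<Rightarrow> 'a \<Rightarrow> 'a" (infixr "*\<^sub>C" 75)
    and cinner :: "'a \<Rightarrow> 'a \<Rightarrow> complex"
  assumes scaleC_add_right: "a *\<^sub>C (x + y) = a *\<^sub>C x + a *\<^sub>C y"
    and scaleC_add_left: "(a + b) *\<^sub>C x = a *\<^sub>C x + b *\<^sub>C x"
    and scaleC_scaleC: "a *\<^sub>C b *\<^sub>C x = (a * b) *\<^sub>C x"
    and scaleC_one: "1 *\<^sub>C x = x"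
    and scaleR_scaleC: "r *\<^sub>R x = complex_of_real r *\<^sub>C x"
    and cinner_commute: "cinner x y = cnj (cinner y x)"
    and cinner_add_left: "cinner (x + y) z = cinner x z + cinner y z"
    and cinner_scaleC_left: "cinner (a *\<^sub>C x) y = a * cinner x y"
    and cinner_ge_zero: "0 \<le> Re (cinner x x)"
    and cinner_eq_zero_iff: "cinner x x = 0 \<longleftrightarrow> x = 0"
    and norm_eq_sqrt_cinner: "norm x = sqrt (Re (cinner x x))"

global_interpretation complex_vector:
  vector_space "scaleC :: complex \<Rightarrow> 'a \<Rightarrow> 'a::complex_hilbert_space"
  by unfold_locales (rule scaleC_add_right scaleC_add_left scaleC_scaleC scaleC_one)+

definition infinite_dimensional :: "'a::complex_hilbert_space itself \<Rightarrow> bool" where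
  "infinite_dimensional _ \<longleftrightarrow> \<not> (\<exists>B :: 'a set. finite B \<and> complex_vector.span B = UNIV)"

definition bounded_clinear :: "('a::complex_hilbert_space \<Rightarrow> 'a) \<Rightarrow> bool" where
  "bounded_clinear T \<longleftrightarrow>
     Vector_Spaces.linear scaleC scaleC T \<and> (\<exists>K. \<forall>x. norm (T x) \<le> K * norm x)"

text \<open>
  The Hilbert space adjoint.  For bounded operators it exists and is unique by the Riesz
  representation theorem; the choice operator only makes the definition total, as in the
  library's real \<^const>\<open>adjoint\<close>.
\<close>

definition cadjoint :: "('a::complex_hilbert_space \<Rightarrow> 'a) \<Rightarrow> 'a \<Rightarrow> 'a" where
  "cadjoint T = (SOME T'. \<forall>x y. cinner (T x) y = cinner x (T' y))"

definition unitary :: "('a::complex_hilbert_space \<Rightarrow> 'a) \<Rightarrow> bool" where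
  "unitary U \<longleftrightarrow> bounded_clinear U \<and> cadjoint U \<circ> U = id \<and> U \<circ> cadjoint U = id"

definition closed_csubspace :: "'a::complex_hilbert_space set \<Rightarrow> bool" where
  "closed_csubspace M \<longleftrightarrow> complex_vector.subspace M \<and> closed M"

definition reduces :: "'a::complex_hilbert_space set \<Rightarrow> ('a \<Rightarrow> 'a) \<Rightarrow> bool" where
  "reduces M T \<longleftrightarrow> closed_csubspace M \<and> T ` M \<subseteq> M \<and> cadjoint T ` M \<subseteq> M"

text \<open>
  A Hilbert space \<open>M\<close> is given as a closed subspace of the ambient space, and an operator on
  \<open>M\<close> as a function on the ambient space of which only the values on \<open>M\<close> matter.  Thus
  \<open>min_modulus M T\<close> is the minimum modulus of the restriction of \<open>T\<close> to \<open>M\<close>; it is meaningful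
  only for \<open>M \<noteq> {0}\<close>, as the infimum is otherwise taken over the empty set.
\<close>

definition min_modulus :: "'a::complex_hilbert_space set \<Rightarrow> ('a \<Rightarrow> 'a) \<Rightarrow> real" where
  "min_modulus M A = Inf {norm (A x) | x. x \<in> M \<and> norm x = 1}"

definition min_attaining :: "'a::complex_hilbert_space set \<Rightarrow> ('a \<Rightarrow> 'a) \<Rightarrow> bool" where
  "min_attaining M A \<longleftrightarrow> (\<exists>x\<^sub>0\<in>M. norm x\<^sub>0 = 1 \<and> norm (A x\<^sub>0) = min_modulus M A)"

definition M_r :: "('a::complex_hilbert_space \<Rightarrow> 'a) set" where
  "M_r = {T. bounded_clinear T \<and>
             (\<forall>M. M \<noteq> {0} \<and> reduces M T \<longrightarrow> min_attaining M T)}"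

end

theory Submission
  imports Defs
begin

text \<open>
  If \<open>T = U\<^sup>* S U\<close>, then \<open>M \<mapsto> U(M)\<close> maps the subspaces reducing \<open>T\<close> to those reducing \<open>S\<close>, and
  \<open>U\<close> maps the unit vectors of \<open>M\<close> onto those of \<open>U(M)\<close> in such a way that
  \<open>\<parallel>T x\<parallel> = \<parallel>S (U x)\<parallel>\<close>.  That \<open>\<^const>\<open>cadjoint\<close>\<close> really is an adjoint rests on the Riesz
  representation theorem, which is obtained by minimising \<open>\<parallel>x\<parallel>\<^sup>2 - 2 f x\<close> for a bounded
  real-linear functional \<open>f\<close>.
\<close>

section \<open>Inner products and the Riesz representation theorem\<close>

lemma cinner_add_right: "cinner x (y + z) = cinner x y + cinner x z"
  using cinner_add_left[of y z x] cinner_commute by (metis complex_cnj_add)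

lemma cinner_scaleC_right: "cinner x (a *\<^sub>C y) = cnj a * cinner x y"
  using cinner_scaleC_left[of a y x] cinner_commute by (metis complex_cnj_mult)

lemma cinner_scaleR_left: "cinner (r *\<^sub>R x) y = complex_of_real r * cinner x y"
  by (simp add: scaleR_scaleC cinner_scaleC_left)

lemma cinner_scaleR_right: "cinner x (r *\<^sub>R y) = complex_of_real r * cinner x y"
  by (simp add: scaleR_scaleC cinner_scaleC_right)

lemma cinner_minus_left: "cinner (- x) y = - cinner x y"
  using cinner_scaleR_left[of "-1" x y] by simp

lemma cinner_minus_right: "cinner x (- y) = - cinner x y"
  using cinner_scaleR_right[of x "-1" y] by simp

lemma cinner_diff_left: "cinner (x - y) z = cinner x z - cinner y z"
  using cinner_add_left[of x "- y" z] by (simp add: cinner_minus_left)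

lemma cinner_diff_right: "cinner x (y - z) = cinner x y - cinner x z"
  using cinner_add_right[of x y "- z"] by (simp add: cinner_minus_right)

lemma Re_cinner_commute: "Re (cinner x y) = Re (cinner y x)"
  by (subst cinner_commute) simp

lemma norm_power2_cinner: "(norm x)\<^sup>2 = Re (cinner x x)"
  by (simp add: norm_eq_sqrt_cinner cinner_ge_zero)

lemma norm_add_power2: "(norm (x + y))\<^sup>2 = (norm x)\<^sup>2 + (norm y)\<^sup>2 + 2 * Re (cinner x y)"
  by (simp add: norm_power2_cinner cinner_add_left cinner_add_right Re_cinner_commute[of y x])

lemma norm_diff_power2: "(norm (x - y))\<^sup>2 = (norm x)\<^sup>2 + (norm y)\<^sup>2 - 2 * Re (cinner x y)"
  by (simp add: norm_power2_cinner cinner_diff_left cinner_diff_right Re_cinner_commute[of y x])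

text \<open>
  The class assumes the triangle inequality, as part of \<^class>\<open>banach\<close>, so the Cauchy--Schwarz
  inequality can be read off from it.
\<close>

lemma Re_cinner_le: "Re (cinner x y) \<le> norm x * norm y"
proof -
  have "(norm (x + y))\<^sup>2 \<le> (norm x + norm y)\<^sup>2"
    by (rule power_mono[OF norm_triangle_ineq norm_ge_zero])
  then show ?thesis
    by (simp add: norm_add_power2 power2_sum)
qed

lemma abs_Re_cinner_le: "\<bar>Re (cinner x y)\<bar> \<le> norm x * norm y"
  using Re_cinner_le[of x y] Re_cinner_le[of "- x" y] by (simp add: cinner_minus_left)

text \<open>Testing with \<open>x = y - z\<close> makes the squared norm of \<open>y - z\<close>
  vanish.\<close>

lemma cinner_eqI_Re:
  assumes "\<And>x. Re (cinner x y) = Re (cinner x z)"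
  shows "y = z"
proof -
  have "Re (cinner (y - z) (y - z)) = 0"
    using assms[of "y - z"] by (simp add: cinner_diff_right)
  then show ?thesis
    using norm_eq_sqrt_cinner[of "y - z"] by simp
qed

text \<open>First-order optimality: near 0 the linear term dominates, so a nonzero \<open>b\<close>
  would make some value negative.\<close>

lemma zero_if_quadratic_nonneg:
  fixes a b :: real
  assumes "\<And>t. 0 \<le> t\<^sup>2 * a + 2 * t * b"
  shows "b = 0"
proof (rule ccontr)
  assume "b \<noteq> 0"
  have "a \<ge> 0"
    using assms[of 1] assms[of "-1"] by simp
  \<comment> \<open>The vertex of the parabola with \<open>a + 1\<close> in place of
    \<open>a\<close>, so that \<open>a = 0\<close> causes no division by zero.\<close>
  define t where "t = - b / (a + 1)"
  have "t * (a + 1) = - b"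
    using \<open>a \<ge> 0\<close> by (simp add: t_def)
  then have b: "b = - t * (a + 1)"
    by simp
  have "t \<noteq> 0"
    using \<open>b \<noteq> 0\<close> b by auto
  have "t\<^sup>2 * a + 2 * t * b = - (t\<^sup>2 * (a + 2))"
    unfolding b by (simp add: power2_eq_square algebra_simps)
  moreover have "t\<^sup>2 * (a + 2) > 0"
    using \<open>t \<noteq> 0\<close> \<open>a \<ge> 0\<close> by simp
  ultimately show False
    using assms[of t] by simp
qed

lemma riesz_representation_Re:
  fixes f :: "'a::complex_hilbert_space \<Rightarrow> real"
  assumes "bounded_linear f"
  obtains z where "\<And>x. f x = Re (cinner x z)"
proof -
  interpret f: bounded_linear f by fact
  obtain K where K: "\<And>x. norm (f x) \<le> norm x * K"
    using f.bounded by blast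
  define J where "J x = (norm x)\<^sup>2 - 2 * f x" for x
  define m where "m = Inf (range J)"
  \<comment> \<open>Complete the square in \<open>norm x\<close>; the infimum \<open>m\<close> is
    then a genuine lower bound.\<close>
  have J_ge: "- K\<^sup>2 \<le> J x" for x
  proof -
    have "f x \<le> norm x * K"
      using K[of x] by simp
    moreover have "0 \<le> (norm x - K)\<^sup>2"
      by simp
    ultimately show ?thesis
      unfolding J_def power2_diff by (simp add: algebra_simps)
  qed
  then have m_le: "m \<le> J x" for x
    unfolding m_def by (intro cInf_lower bdd_belowI2) auto
  have "\<exists>x. J x < m + 1 / real (Suc n)" for n
    using cInf_lessD[of "range J" "m + 1 / real (Suc n)"] by (auto simp: m_def)
  then obtain X where X: "\<And>n. J (X n) < m + 1 / real (Suc n)"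
    by metis
  text \<open>The parallelogram law turns near-minimality of \<open>J\<close> into closeness.\<close>
  have diff_le: "(norm (x - y))\<^sup>2 \<le> 2 * (J x - m) + 2 * (J y - m)" for x y
  proof -
    have "4 * J ((1/2) *\<^sub>R (x + y)) = (norm (x + y))\<^sup>2 - 4 * (f x + f y)"
      by (simp add: J_def f.scaleR f.add power_divide add_divide_distrib)
    then have "(norm (x - y))\<^sup>2 = 2 * J x + 2 * J y - 4 * J ((1/2) *\<^sub>R (x + y))"
      by (simp add: J_def norm_add_power2 norm_diff_power2)
    then show ?thesis
      using m_le[of "(1/2) *\<^sub>R (x + y)"] by simp
  qed
  have "Cauchy X"
  proof (rule metric_CauchyI)
    fix e :: real
    assume "e > 0"
    \<comment> \<open>In \<open>diff_le\<close> each of the two excesses over \<open>m\<close>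
      counts twice, hence the quarter.\<close>
    then obtain N where N: "1 / real (Suc N) < e\<^sup>2 / 4"
      using nat_approx_posE[of "e\<^sup>2 / 4"] by auto
    have "dist (X i) (X j) < e" if "i \<ge> N" "j \<ge> N" for i j
    proof -
      have near: "J (X k) - m < e\<^sup>2 / 4" if "k \<ge> N" for k
      proof -
        have "1 / real (Suc k) \<le> 1 / real (Suc N)"
          using that by (simp add: frac_le)
        then show ?thesis
          using X[of k] N by linarith
      qed
      note diff_le[of "X i" "X j"]
      also have "2 * (J (X i) - m) + 2 * (J (X j) - m) < e\<^sup>2"
        using near[OF that(1)] near[OF that(2)] by simp
      finally show ?thesis
        using \<open>e > 0\<close> by (simp add: dist_norm power_less_imp_less_base)
    qed
    then show "\<exists>M. \<forall>i\<ge>M. \<forall>j\<ge>M. dist (X i) (X j) < e"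
      by blast
  qed
  then obtain z where z: "X \<longlonglongrightarrow> z"
    using Cauchy_convergent convergent_def by blast
  have "(\<lambda>n. J (X n)) \<longlonglongrightarrow> J z"
    unfolding J_def by (intro tendsto_intros f.tendsto z)
  moreover have "(\<lambda>n. m + 1 / real (Suc n)) \<longlonglongrightarrow> m + 0"
    by (intro tendsto_add tendsto_const LIMSEQ_Suc lim_1_over_n)
  ultimately have "J z \<le> m"
    using X by (intro LIMSEQ_le[of "\<lambda>n. J (X n)" _ "\<lambda>n. m + 1 / real (Suc n)"])
      (auto intro: less_imp_le)
  have "f h = Re (cinner h z)" for h
  proof -
    \<comment> \<open>Perturb the minimiser \<open>z\<close> along \<open>h\<close>: the coefficient
      of \<open>t\<close> is half the directional derivative of \<open>J\<close> at \<open>z\<close>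
      and must vanish.\<close>
    have "0 \<le> t\<^sup>2 * (norm h)\<^sup>2 + 2 * t * (Re (cinner z h) - f h)" for t
    proof -
      have "J (z + t *\<^sub>R h) - J z = t\<^sup>2 * (norm h)\<^sup>2 + 2 * t * (Re (cinner z h) - f h)"
        by (simp add: J_def norm_add_power2 cinner_scaleR_right f.add f.scaleR
            power_mult_distrib algebra_simps)
      then show ?thesis
        using m_le[of "z + t *\<^sub>R h"] \<open>J z \<le> m\<close> by linarith
    qed
    then have "Re (cinner z h) - f h = 0"
      by (rule zero_if_quadratic_nonneg)
    then show ?thesis
      by (simp add: Re_cinner_commute)
  qed
  then show thesis
    by (rule that)
qed

section \<open>Adjoints\<close>

lemma bounded_clinear_bounded_linear:
  assumes "bounded_clinear T"
  shows "bounded_linear T"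
proof -
  interpret T: Vector_Spaces.linear scaleC scaleC T
    using assms by (simp add: bounded_clinear_def)
  obtain K where "\<And>x. norm (T x) \<le> K * norm x"
    using assms by (auto simp: bounded_clinear_def)
  then show ?thesis
    by (intro bounded_linear_intro[where K = K])
      (simp_all add: T.add T.scale scaleR_scaleC mult.commute)
qed

lemma cadjoint_exists:
  fixes T :: "'a::complex_hilbert_space \<Rightarrow> 'a"
  assumes "bounded_clinear T"
  shows "\<exists>T'. \<forall>x y. cinner (T x) y = cinner x (T' y)"
proof -
  interpret T: Vector_Spaces.linear scaleC scaleC T
    using assms by (simp add: bounded_clinear_def)
  interpret B: bounded_linear T
    using assms by (rule bounded_clinear_bounded_linear)
  have "\<exists>z. \<forall>x. cinner (T x) y = cinner x z" for y
  proof -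
    obtain K where K: "\<And>x. norm (T x) \<le> norm x * K"
      using B.bounded by blast
    have "bounded_linear (\<lambda>x. Re (cinner (T x) y))"
    proof (rule bounded_linear_intro[where K = "K * norm y"])
      fix x
      have "\<bar>Re (cinner (T x) y)\<bar> \<le> norm (T x) * norm y"
        by (rule abs_Re_cinner_le)
      also have "\<dots> \<le> (norm x * K) * norm y"
        by (intro mult_right_mono K norm_ge_zero)
      finally show "norm (Re (cinner (T x) y)) \<le> norm x * (K * norm y)"
        by (simp add: mult.assoc)
    qed (simp_all add: B.add B.scaleR cinner_add_left cinner_scaleR_left)
    then obtain z where z: "\<And>x. Re (cinner (T x) y) = Re (cinner x z)"
      using riesz_representation_Re by blast
    \<comment> \<open>Since Re(-i w) = Im w, complex linearity recovers the imaginary parts from the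
      real ones.\<close>
    have "Im (cinner (T x) y) = Im (cinner x z)" for x
      using z[of "(- \<i>) *\<^sub>C x"] unfolding T.scale cinner_scaleC_left by simp
    with z show ?thesis
      by (metis complex_eqI)
  qed
  then show ?thesis
    by metis
qed

lemma cinner_cadjoint:
  assumes "bounded_clinear T"
  shows "cinner (T x) y = cinner x (cadjoint T y)"
  using someI_ex[OF cadjoint_exists[OF assms]] unfolding cadjoint_def by blast

text \<open>The given \<open>T'\<close> shows that the choice in \<open>cadjoint\<close> picks a
  true adjoint, and adjoints are unique by \<open>cinner_eqI_Re\<close>.\<close>

lemma cadjoint_eqI:
  assumes "\<And>x y. cinner (T x) y = cinner x (T' y)"
  shows "cadjoint T = T'"
proof -
  have "\<forall>x y. cinner (T x) y = cinner x (cadjoint T y)"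
    unfolding cadjoint_def
    by (rule someI[of "\<lambda>T'. \<forall>x y. cinner (T x) y = cinner x (T' y)" T']) (intro allI assms)
  then show ?thesis
    using assms by (intro ext cinner_eqI_Re) metis
qed

section \<open>Unitary equivalence\<close>

context
  fixes U :: "'a::complex_hilbert_space \<Rightarrow> 'a"
  assumes unitary: "unitary U"
begin

lemma unitary_bounded_clinear: "bounded_clinear U"
  using unitary by (simp add: unitary_def)

lemma unitary_cadjoint_left [simp]: "cadjoint U (U x) = x"
  using unitary by (simp add: unitary_def pointfree_idE)

lemma unitary_cadjoint_right [simp]: "U (cadjoint U x) = x"
  using unitary by (simp add: unitary_def pointfree_idE)

lemma unitary_cinner_cadjoint: "cinner (cadjoint U x) y = cinner x (U y)"
  using cinner_cadjoint[OF unitary_bounded_clinear, of "cadjoint U x" "U y"] by simp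

lemma unitary_norm [simp]: "norm (U x) = norm x"
  using cinner_cadjoint[OF unitary_bounded_clinear, of x "U x"] by (simp add: norm_eq_sqrt_cinner)

lemma unitary_norm_cadjoint [simp]: "norm (cadjoint U x) = norm x"
  using unitary_norm[of "cadjoint U x"] by simp

lemma bounded_clinear_cadjoint_unitary: "bounded_clinear (cadjoint U)"
proof -
  interpret U: Vector_Spaces.linear scaleC scaleC U
    using unitary_bounded_clinear by (simp add: bounded_clinear_def)
  have "cadjoint U (x + y) = cadjoint U x + cadjoint U y" for x y
    using unitary_cadjoint_left[of "cadjoint U x + cadjoint U y"] by (simp add: U.add)
  moreover have "cadjoint U (c *\<^sub>C x) = c *\<^sub>C cadjoint U x" for c x
    using unitary_cadjoint_left[of "c *\<^sub>C cadjoint U x"] by (simp add: U.scale)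
  ultimately have "Vector_Spaces.linear scaleC scaleC (cadjoint U)"
    by unfold_locales auto
  then show ?thesis
    unfolding bounded_clinear_def by (auto intro: exI[of _ 1])
qed

lemma cadjoint_cadjoint_unitary: "cadjoint (cadjoint U) = U"
  by (rule cadjoint_eqI) (rule unitary_cinner_cadjoint)

text \<open>Allows the facts of this context to be applied to the inverse of \<open>U\<close>, which
  yields the converse direction of the theorem.\<close>

lemma unitary_cadjoint: "unitary (cadjoint U)"
  using unitary bounded_clinear_cadjoint_unitary
  by (simp add: unitary_def cadjoint_cadjoint_unitary)

lemma cadjoint_unitary_conj:
  assumes "bounded_clinear S"
  shows "cadjoint (cadjoint U \<circ> S \<circ> U) = cadjoint U \<circ> cadjoint S \<circ> U"
  by (rule cadjoint_eqI)
    (simp add: unitary_cinner_cadjoint cinner_cadjoint[OF assms]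
      cinner_cadjoint[OF unitary_bounded_clinear])

lemma closed_csubspace_unitary_image:
  assumes "closed_csubspace M"
  shows "closed_csubspace (U ` M)"
proof -
  interpret U: Vector_Spaces.linear scaleC scaleC U
    using unitary_bounded_clinear by (simp add: bounded_clinear_def)
  \<comment> \<open>As a preimage under a continuous map the set is closed; as a linear image it is
    a subspace.\<close>
  have eq: "U ` M = cadjoint U -` M"
    by (force simp: image_iff intro: unitary_cadjoint_right[symmetric])
  have "closed (U ` M)"
    unfolding eq
    using assms bounded_clinear_cadjoint_unitary
    by (auto simp: closed_csubspace_def
        intro!: closed_vimage linear_continuous_on bounded_clinear_bounded_linear)
  then show ?thesis
    using assms U.subspace_image[of M] by (simp add: closed_csubspace_def)
qed

lemma reduces_unitary_image:
  assumes "bounded_clinear S" and "reduces M (cadjoint U \<circ> S \<circ> U)"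
  shows "reduces (U ` M) S"
proof -
  \<comment> \<open>Kept general in \<open>A\<close> to serve both \<open>S\<close> and
    \<open>cadjoint S\<close>.\<close>
  have "A ` U ` M \<subseteq> U ` M" if "(cadjoint U \<circ> A \<circ> U) ` M \<subseteq> M" for A
  proof clarify
    fix x assume "x \<in> M"
    then have "cadjoint U (A (U x)) \<in> M"
      using that by auto
    then show "A (U x) \<in> U ` M"
      by (metis imageI unitary_cadjoint_right)
  qed
  then show ?thesis
    using assms unfolding reduces_def cadjoint_unitary_conj[OF assms(1)]
    by (blast intro: closed_csubspace_unitary_image)
qed

text \<open>The inner \<open>U\<close> matches up the unit vectors, and the outer
  \<open>cadjoint U\<close> preserves norms, so both infima range over the same set.\<close>

lemma min_modulus_unitary_image: "min_modulus (U ` M) S = min_modulus M (cadjoint U \<circ> S \<circ> U)"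
proof -
  have "{norm (S x) | x. x \<in> U ` M \<and> norm x = 1} = {norm (S (U x)) | x. x \<in> M \<and> norm x = 1}"
    by (auto; metis unitary_norm)
  then show ?thesis
    by (simp add: min_modulus_def)
qed

lemma min_attaining_unitary_image:
  "min_attaining (U ` M) S \<longleftrightarrow> min_attaining M (cadjoint U \<circ> S \<circ> U)"
  by (simp add: min_attaining_def min_modulus_unitary_image)

lemma M_r_unitary_conj:
  assumes "S \<in> M_r" and "bounded_clinear (cadjoint U \<circ> S \<circ> U)"
  shows "cadjoint U \<circ> S \<circ> U \<in> M_r"
proof -
  have "min_attaining M (cadjoint U \<circ> S \<circ> U)"
    if "M \<noteq> {0}" "reduces M (cadjoint U \<circ> S \<circ> U)" for M
  proof -
    have "U ` M \<noteq> {0}"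
    proof
      assume *: "U ` M = {0}"
      then have "x = 0" if "x \<in> M" for x
        using that unitary_norm[of x] by (metis imageI norm_eq_zero singletonD)
      \<comment> \<open>With all its elements zero, \<open>M\<close> is empty or \<open>{0}\<close>;
        \<open>*\<close> rules out the empty set.\<close>
      with * \<open>M \<noteq> {0}\<close> show False
        by blast
    qed
    moreover have "reduces (U ` M) S"
      using assms(1) that(2) by (intro reduces_unitary_image) (simp_all add: M_r_def)
    ultimately show ?thesis
      using assms(1) by (simp add: M_r_def flip: min_attaining_unitary_image)
  qed
  with assms(2) show ?thesis
    by (simp add: M_r_def)
qed

end

theorem proposition3p19:
  fixes T S :: "'h::complex_hilbert_space \<Rightarrow> 'h"
  assumes "infinite_dimensional TYPE('h)"
    and "separable_space (euclidean :: 'h topology)"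
    and "bounded_clinear T" and "bounded_clinear S"
    and "\<exists>U. unitary U \<and> T = cadjoint U \<circ> S \<circ> U"
  shows "T \<in> M_r \<longleftrightarrow> S \<in> M_r"
proof -
  obtain U where U: "unitary U" and T: "T = cadjoint U \<circ> S \<circ> U"
    using assms(5) by blast
  \<comment> \<open>The relation solved for \<open>S\<close>, in the form
    \<open>M_r_unitary_conj\<close> needs for the unitary \<open>cadjoint U\<close>.\<close>
  have S: "S = cadjoint (cadjoint U) \<circ> T \<circ> cadjoint U"
    by (simp add: T cadjoint_cadjoint_unitary[OF U] fun_eq_iff
        unitary_cadjoint_right[OF U])
  show ?thesis
  proof
    assume "T \<in> M_r"
    then show "S \<in> M_r"
      using M_r_unitary_conj[OF unitary_cadjoint[OF U], of T] assms(4) S by simp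
  next
    assume "S \<in> M_r"
    then show "T \<in> M_r"
      using M_r_unitary_conj[OF U, of S] assms(3) T by simp
  qed
qed

end
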